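(* Let $(V,\mathcal{V})$ be a simple majority voting system with $N$ voters, and let $v\in V$. Then $$S_S^+(v)=\begin{cases}\frac38+\frac18\frac1N & \text{for odd } N,\\ \frac38-\frac18\frac1{N+1} & \text{for even } N,\end{cases}$$ $$S_S^-(v)=\begin{cases}\frac38+\frac18\frac1N & \text{for odd } N,\\ \frac38+\frac38\frac1{N+1} & \text{for even } N.\end{cases}$$ Consequently $$S_S(v)=\begin{cases}\frac34+\frac14\frac1N & \text{for odd } N,\\ \frac34+\frac14\frac1{N+1} & \text{for even } N.\end{cases}$$ In particular, $S_S(v)\approx\frac34$ as $N\to\infty$.
   Context: The simple majority voting system with $N$ voters consists of a set $V$ with $|V|=N$ and the family $\mathcal{V}$ of winning coalitions, where a coalition $A\subset V$ is winning ($A\in\mathcal{V}$) if and only if it contains more than half of the voters, $|A|>N/2$ (equivalently: all weights equal $1$ and relative quota $r=\frac12+\frac1{2N}$, i.e. $|A|\ge rN$). The Shapley-Shubik measure $\mathbb{P}_S$ is the probability measure on the power set $\mathcal{P}(V)$ giving each coalition $A$ with $|A|=k$ the probability $\mathbb{P}_S(A)=\frac{1}{N+1}\frac{1}{\binom Nk}$. The rate of affirmative success of $v$ is $S_S^+(v)=\mathbb{P}_S(\{A\in\mathcal{V}\mid v\in A\})$, the rate of blocking success is $S_S^-(v)=\mathbb{P}_S(\{A\subset V\mid A\notin\mathcal{V}, v\notin A\})$, and the (total) rate of success is $S_S(v)=S_S^+(v)+S_S^-(v)$. $a_N\approx b_N$ as $N\to\infty$ means $a_N/b_N\to1$ as $N\to\infty$.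 *)

theory Defs
  imports "HOL-Probability.Probability"
begin

text \<open>A voting system is given by a finite set \<open>V\<close> of voters and the family \<open>W\<close> of its winning
  coalitions, where \<open>W \<subseteq> Pow V\<close>.\<close>

definition simple_majority :: "'a set \<Rightarrow> 'a set set" where
  "simple_majority V = {A. A \<subseteq> V \<and> real (card A) > real (card V) / 2}"

definition shapley_shubik :: "'a set \<Rightarrow> 'a set measure" where
  "shapley_shubik V = point_measure (Pow V)
     (\<lambda>A. ennreal (1 / (real (card V) + 1) * (1 / real (card V choose card A))))"

lemma prob_space_shapley_shubik:
  assumes "finite V"
  shows "prob_space (shapley_shubik V)"
proof
  let ?N = "card V"
  let ?f = "\<lambda>k. 1 / (real ?N + 1) * (1 / real (?N choose k))"
  have "(\<Sum>A\<in>Pow V. ?f (card A)) = (\<Sum>k\<le>?N. \<Sum>A\<in>{A\<in>Pow V. card A = k}. ?f (card A))"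
    using assms by (intro sum.group[symmetric]) (auto intro: card_mono)
  also have "\<dots> = (\<Sum>k\<le>?N. real (?N choose k) * ?f k)"
    using assms by (intro sum.cong) (auto simp: n_subsets)
  also have "\<dots> = (\<Sum>k\<le>?N. 1 / (real ?N + 1))"
    by (intro sum.cong) auto
  also have "\<dots> = 1"
    by (simp add: field_simps)
  finally have *: "(\<Sum>A\<in>Pow V. ?f (card A)) = 1" .
  have "emeasure (shapley_shubik V) (Pow V) = (\<Sum>A\<in>Pow V. ennreal (?f (card A)))"
    using assms unfolding shapley_shubik_def by (intro emeasure_point_measure_finite) auto
  also have "\<dots> = ennreal (\<Sum>A\<in>Pow V. ?f (card A))"
    by (intro sum_ennreal) auto
  finally show "emeasure (shapley_shubik V) (space (shapley_shubik V)) = 1"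
    using * by (simp add: shapley_shubik_def space_point_measure)
qed

definition affirmative_success :: "'a set \<Rightarrow> 'a set set \<Rightarrow> 'a \<Rightarrow> real" where
  "affirmative_success V W v = measure (shapley_shubik V) {A \<in> W. v \<in> A}"

definition blocking_success :: "'a set \<Rightarrow> 'a set set \<Rightarrow> 'a \<Rightarrow> real" where
  "blocking_success V W v = measure (shapley_shubik V) {A. A \<subseteq> V \<and> A \<notin> W \<and> v \<notin> A}"

definition success :: "'a set \<Rightarrow> 'a set set \<Rightarrow> 'a \<Rightarrow> real" where
  "success V W v = affirmative_success V W v + blocking_success V W v"

end

theory Submission
  imports Defs
begin

text \<open>Under the Shapley--Shubik measure the size of a coalition is uniformly distributed on
  \<open>{0, \<dots>, N}\<close>, and given its size \<open>k\<close> all coalitions are equally likely. By symmetry between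
  the voters, \<open>v\<close> belongs to a random coalition of size \<open>k\<close> with probability \<open>k / N\<close>. Whether a
  coalition wins depends on its size alone, namely on whether \<open>k > m\<close> for \<open>m = N div 2\<close>. So
  affirmative success has probability \<open>\<Sum>k>m. k / (N (N + 1))\<close> and blocking success has probability
  \<open>\<Sum>k\<le>m. (N - k) / (N (N + 1))\<close>. These are arithmetic progressions, and the closed
  forms follow on inserting \<open>m = (N - 1) / 2\<close> or \<open>m = N / 2\<close>. The asymptotic
  statement holds because the total rate differs from \<open>3 / 4\<close> by at most \<open>1 / (4 n)\<close>.\<close>

text \<open>Conditioning on the size: the coalitions of size \<open>k\<close> all carry the same mass, so the
  probability of an event is obtained by counting its members of each size.\<close>

lemma measure_shapley_shubik_by_size:
  assumes "finite V" and K: "K \<subseteq> {..card V}"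
  shows "measure (shapley_shubik V) {A. A \<subseteq> V \<and> card A \<in> K \<and> P A} =
    (\<Sum>k\<in>K. real (card {A. A \<subseteq> V \<and> card A = k \<and> P A})
              / ((real (card V) + 1) * real (card V choose k)))"
proof -
  let ?f = "\<lambda>k. 1 / (real (card V) + 1) * (1 / real (card V choose k))"
  let ?E = "{A. A \<subseteq> V \<and> card A \<in> K \<and> P A}"
  have fin: "finite (Pow V)" "finite ?E" "finite K"
    using assms by (auto intro: finite_subset[of _ "{..card V}"])
  have "emeasure (shapley_shubik V) ?E = (\<Sum>A\<in>?E. ennreal (?f (card A)))"
    using fin unfolding shapley_shubik_def by (intro emeasure_point_measure_finite) auto
  also have "\<dots> = ennreal (\<Sum>A\<in>?E. ?f (card A))"
    by (intro sum_ennreal) auto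
  finally have "measure (shapley_shubik V) ?E = (\<Sum>A\<in>?E. ?f (card A))"
    by (simp add: measure_def sum_nonneg)
  also have "\<dots> = (\<Sum>k\<in>K. \<Sum>A\<in>{A\<in>?E. card A = k}. ?f (card A))"
    using fin by (intro sum.group[symmetric]) auto
  also have "\<dots> = (\<Sum>k\<in>K. real (card {A. A \<subseteq> V \<and> card A = k \<and> P A}) * ?f k)"
  proof (intro sum.cong refl)
    fix k assume "k \<in> K"
    then have "{A\<in>?E. card A = k} = {A. A \<subseteq> V \<and> card A = k \<and> P A}"
      by auto
    then show "(\<Sum>A\<in>{A\<in>?E. card A = k}. ?f (card A)) =
        real (card {A. A \<subseteq> V \<and> card A = k \<and> P A}) * ?f k"
      by simp
  qed
  finally show ?thesis
    by simp
qed

lemma card_subsets_avoiding: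
  assumes "finite V" and "v \<in> V"
  shows "card {A. A \<subseteq> V \<and> card A = k \<and> v \<notin> A} = (card V - 1) choose k"
proof -
  have "{A. A \<subseteq> V \<and> card A = k \<and> v \<notin> A} = {A. A \<subseteq> V - {v} \<and> card A = k}"
    by auto
  then show ?thesis
    using assms by (simp add: n_subsets)
qed

text \<open>The absorption identity \<open>(N - k) * (N choose k) = N * ((N - 1) choose k)\<close> turns the ratio of
  the two binomial coefficients into a linear function of \<open>k\<close>; this is what makes the success
  rates sums of arithmetic progressions.\<close>

lemma proportion_subsets_avoiding:
  assumes "finite V" and "v \<in> V" and "k \<le> card V"
  shows "real (card {A. A \<subseteq> V \<and> card A = k \<and> v \<notin> A}) / real (card V choose k) =
    (real (card V) - real k) / real (card V)"
proof -
  have "card V > 0"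
    using assms by (auto simp: card_gt_0_iff)
  moreover have "real (card V - k) * real (card V choose k) = real (card V) * real ((card V - 1) choose k)"
    unfolding of_nat_mult[symmetric] by (simp only: binomial_absorb_comp)
  ultimately show ?thesis
    using assms by (auto simp: card_subsets_avoiding of_nat_diff field_simps)
qed

text \<open>The coalitions of size \<open>k\<close> that contain \<open>v\<close> are those that do not avoid it, so their
  proportion is \<open>1 - (N - k) / N\<close>. Passing to the complement avoids the case \<open>k = 0\<close>, in which
  removing \<open>v\<close> from a coalition would make no sense.\<close>

lemma proportion_subsets_containing:
  assumes "finite V" and "v \<in> V" and "k \<le> card V"
  shows "real (card {A. A \<subseteq> V \<and> card A = k \<and> v \<in> A}) / real (card V choose k) =
    real k / real (card V)"
proof -
  let ?C = "{A. A \<subseteq> V \<and> card A = k \<and> v \<in> A}" and ?D = "{A. A \<subseteq> V \<and> card A = k \<and> v \<notin> A}"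
  have "card (?C \<union> ?D) = card ?C + card ?D"
    using assms by (intro card_Un_disjoint) auto
  moreover have "?C \<union> ?D = {A. A \<subseteq> V \<and> card A = k}"
    by auto
  ultimately have "card V choose k = card ?C + card ?D"
    using assms by (simp add: n_subsets)
  then have "real (card ?C) = real (card V choose k) - real (card ?D)"
    by simp
  moreover have "card V > 0"
    using assms by (auto simp: card_gt_0_iff)
  ultimately show ?thesis
    using proportion_subsets_avoiding[OF assms] assms(3) by (simp add: diff_divide_distrib)
qed

lemma affirmative_success_eq_sum:
  assumes "finite V" and "v \<in> V"
  shows "affirmative_success V (simple_majority V) v =
    (\<Sum>k\<in>{card V div 2<..card V}. real k / (real (card V) * (real (card V) + 1)))"
proof -
  let ?K = "{card V div 2<..card V}"
  have K: "?K \<subseteq> {..card V}"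
    by auto
  have "{A \<in> simple_majority V. v \<in> A} = {A. A \<subseteq> V \<and> card A \<in> ?K \<and> v \<in> A}"
    using assms(1) by (auto simp: simple_majority_def card_mono)
  then have "affirmative_success V (simple_majority V) v =
    (\<Sum>k\<in>?K. real (card {A. A \<subseteq> V \<and> card A = k \<and> v \<in> A})
              / ((real (card V) + 1) * real (card V choose k)))"
    unfolding affirmative_success_def
    by (simp only: measure_shapley_shubik_by_size[OF assms(1) K])
  also have "\<dots> = (\<Sum>k\<in>?K. real (card {A. A \<subseteq> V \<and> card A = k \<and> v \<in> A})
              / real (card V choose k) / (real (card V) + 1))"
    by (simp add: mult.commute)
  also have "\<dots> = (\<Sum>k\<in>?K. real k / (real (card V) * (real (card V) + 1)))"
    using assms by (intro sum.cong) (auto simp: proportion_subsets_containing)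
  finally show ?thesis .
qed

lemma blocking_success_eq_sum:
  assumes "finite V" and "v \<in> V"
  shows "blocking_success V (simple_majority V) v =
    (\<Sum>k\<le>card V div 2. (real (card V) - real k) / (real (card V) * (real (card V) + 1)))"
proof -
  let ?K = "{..card V div 2}"
  have K: "?K \<subseteq> {..card V}"
    by auto
  have "{A. A \<subseteq> V \<and> A \<notin> simple_majority V \<and> v \<notin> A} = {A. A \<subseteq> V \<and> card A \<in> ?K \<and> v \<notin> A}"
    by (auto simp: simple_majority_def)
  then have "blocking_success V (simple_majority V) v =
    (\<Sum>k\<in>?K. real (card {A. A \<subseteq> V \<and> card A = k \<and> v \<notin> A})
              / ((real (card V) + 1) * real (card V choose k)))"
    unfolding blocking_success_def
    by (simp only: measure_shapley_shubik_by_size[OF assms(1) K])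
  also have "\<dots> = (\<Sum>k\<in>?K. real (card {A. A \<subseteq> V \<and> card A = k \<and> v \<notin> A})
              / real (card V choose k) / (real (card V) + 1))"
    by (simp add: mult.commute)
  also have "\<dots> = (\<Sum>k\<in>?K. (real (card V) - real k) / (real (card V) * (real (card V) + 1)))"
    using assms by (intro sum.cong) (auto simp: proportion_subsets_avoiding)
  finally show ?thesis .
qed

lemma sum_real_atMost: "(\<Sum>k\<le>n. real k) = real n * (real n + 1) / 2"
  by (induction n) (auto simp: field_simps)

lemma sum_real_greaterThanAtMost:
  assumes "m \<le> n"
  shows "(\<Sum>k\<in>{m<..n}. real k) = (real n * (real n + 1) - real m * (real m + 1)) / 2"
proof -
  have "(\<Sum>k\<le>n. real k) = (\<Sum>k\<le>m. real k) + (\<Sum>k\<in>{m<..n}. real k)"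
    using assms by (subst sum.union_disjoint[symmetric]) (auto simp: ivl_disj_un)
  then show ?thesis
    by (simp add: sum_real_atMost field_simps)
qed

lemma affirmative_success_simple_majority:
  assumes "finite V" and "v \<in> V"
  defines "N \<equiv> card V"
  shows "affirmative_success V (simple_majority V) v =
    (if odd N then 3 / 8 + 1 / 8 * (1 / real N) else 3 / 8 - 1 / 8 * (1 / (real N + 1)))"
proof -
  let ?m = "N div 2"
  have N: "N > 0"
    using assms by (auto simp: card_gt_0_iff)
  have eq: "affirmative_success V (simple_majority V) v =
      (real N * (real N + 1) - real ?m * (real ?m + 1)) / (2 * real N * (real N + 1))"
    using affirmative_success_eq_sum[OF assms(1,2)]
    by (simp add: N_def sum_divide_distrib[symmetric] sum_real_greaterThanAtMost mult.assoc)
  show ?thesis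
  proof (cases "odd N")
    case True
    then have m: "real ?m = (real N - 1) / 2"
      by (auto elim!: oddE)
    show ?thesis
      using True N unfolding eq m by (simp add: divide_simps) (simp add: algebra_simps)
  next
    case False
    then have m: "real ?m = real N / 2"
      by (auto elim!: evenE)
    show ?thesis
      using False N unfolding eq m by (simp add: divide_simps) (simp add: algebra_simps)
  qed
qed

lemma blocking_success_simple_majority:
  assumes "finite V" and "v \<in> V"
  defines "N \<equiv> card V"
  shows "blocking_success V (simple_majority V) v =
    (if odd N then 3 / 8 + 1 / 8 * (1 / real N) else 3 / 8 + 3 / 8 * (1 / (real N + 1)))"
proof -
  let ?m = "N div 2"
  have N: "N > 0"
    using assms by (auto simp: card_gt_0_iff)
  have eq: "blocking_success V (simple_majority V) v =
      ((real ?m + 1) * real N - real ?m * (real ?m + 1) / 2) / (real N * (real N + 1))"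
  proof -
    have "(\<Sum>k\<le>?m. real N - real k) = (real ?m + 1) * real N - real ?m * (real ?m + 1) / 2"
      by (simp add: sum_subtractf sum_real_atMost algebra_simps)
    then show ?thesis
      using blocking_success_eq_sum[OF assms(1,2)]
      by (simp only: N_def sum_divide_distrib[symmetric])
  qed
  show ?thesis
  proof (cases "odd N")
    case True
    then have m: "real ?m = (real N - 1) / 2"
      by (auto elim!: oddE)
    show ?thesis
      using True N unfolding eq m by (simp add: divide_simps) (simp add: algebra_simps)
  next
    case False
    then have m: "real ?m = real N / 2"
      by (auto elim!: evenE)
    show ?thesis
      using False N unfolding eq m by (simp add: divide_simps) (simp add: algebra_simps)
  qed
qed

lemma success_simple_majority:
  assumes "finite V" and "v \<in> V"
  defines "N \<equiv> card V"
  shows "success V (simple_majority V) v =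
    (if odd N then 3 / 4 + 1 / 4 * (1 / real N) else 3 / 4 + 1 / 4 * (1 / (real N + 1)))"
  using affirmative_success_simple_majority[OF assms(1,2)]
    blocking_success_simple_majority[OF assms(1,2)]
  by (auto simp: success_def N_def divide_simps) (simp add: algebra_simps)

text \<open>Since \<open>1 / n\<close> and \<open>1 / (n + 1)\<close> both lie between \<open>0\<close> and \<open>1 / n\<close>, squeezing treats the two
  parities of \<open>n\<close> together.\<close>

lemma success_simple_majority_asymp_equiv:
  fixes U :: "nat \<Rightarrow> 'b set" and u :: "nat \<Rightarrow> 'b"
  assumes U: "\<And>n. n \<ge> 1 \<Longrightarrow> finite (U n) \<and> card (U n) = n \<and> u n \<in> U n"
  shows "(\<lambda>n. success (U n) (simple_majority (U n)) (u n)) \<sim>[sequentially] (\<lambda>_. 3 / 4)"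
proof -
  let ?s = "\<lambda>n. success (U n) (simple_majority (U n)) (u n)"
  have bounds: "3 / 4 \<le> ?s n \<and> ?s n \<le> 3 / 4 + 1 / 4 * (1 / real n)" if "n \<ge> 1" for n
  proof -
    have "1 / 4 * (1 / (real n + 1)) \<le> 1 / 4 * (1 / real n)"
      using that by (simp add: divide_simps)
    then show ?thesis
      using success_simple_majority[of "U n" "u n"] U[OF that] by auto
  qed
  have "?s \<longlonglongrightarrow> 3 / 4"
  proof (rule tendsto_sandwich)
    show "eventually (\<lambda>n. 3 / 4 \<le> ?s n) sequentially"
      using bounds by (auto simp: eventually_sequentially)
    show "eventually (\<lambda>n. ?s n \<le> 3 / 4 + 1 / 4 * (1 / real n)) sequentially"
      using bounds by (auto simp: eventually_sequentially)
    have "(\<lambda>n. 3 / 4 + 1 / 4 * (1 / real n)) \<longlonglongrightarrow> 3 / 4 + 1 / 4 * 0"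
      by (intro tendsto_intros lim_1_over_n)
    then show "(\<lambda>n. 3 / 4 + 1 / 4 * (1 / real n)) \<longlonglongrightarrow> 3 / 4"
      by simp
  qed simp
  then show ?thesis
    by (intro tendsto_imp_asymp_equiv_const) auto
qed

theorem theorem4p6:
  fixes V :: "'a set" and v :: 'a and N :: nat
  assumes "finite V" and "card V = N" and "v \<in> V"
  shows "affirmative_success V (simple_majority V) v =
           (if odd N then 3 / 8 + 1 / 8 * (1 / real N)
            else 3 / 8 - 1 / 8 * (1 / (real N + 1)))
       \<and> blocking_success V (simple_majority V) v =
           (if odd N then 3 / 8 + 1 / 8 * (1 / real N)
            else 3 / 8 + 3 / 8 * (1 / (real N + 1)))
       \<and> success V (simple_majority V) v =
           (if odd N then 3 / 4 + 1 / 4 * (1 / real N)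
            else 3 / 4 + 1 / 4 * (1 / (real N + 1)))
       \<and> (\<forall>(U :: nat \<Rightarrow> 'b set) (u :: nat \<Rightarrow> 'b).
            (\<forall>n\<ge>1. finite (U n) \<and> card (U n) = n \<and> u n \<in> U n) \<longrightarrow>
            (\<lambda>n. success (U n) (simple_majority (U n)) (u n)) \<sim>[sequentially] (\<lambda>_. 3 / 4))"
proof (intro conjI allI impI)
  show "affirmative_success V (simple_majority V) v =
      (if odd N then 3 / 8 + 1 / 8 * (1 / real N) else 3 / 8 - 1 / 8 * (1 / (real N + 1)))"
    using affirmative_success_simple_majority[OF assms(1,3)] unfolding assms(2) .
  show "blocking_success V (simple_majority V) v =
      (if odd N then 3 / 8 + 1 / 8 * (1 / real N) else 3 / 8 + 3 / 8 * (1 / (real N + 1)))"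
    using blocking_success_simple_majority[OF assms(1,3)] unfolding assms(2) .
  show "success V (simple_majority V) v =
      (if odd N then 3 / 4 + 1 / 4 * (1 / real N) else 3 / 4 + 1 / 4 * (1 / (real N + 1)))"
    using success_simple_majority[OF assms(1,3)] unfolding assms(2) .
next
  fix U :: "nat \<Rightarrow> 'b set" and u :: "nat \<Rightarrow> 'b"
  assume "\<forall>n\<ge>1. finite (U n) \<and> card (U n) = n \<and> u n \<in> U n"
  then show "(\<lambda>n. success (U n) (simple_majority (U n)) (u n)) \<sim>[sequentially] (\<lambda>_. 3 / 4)"
    by (intro success_simple_majority_asymp_equiv) blast
qed

end
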